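(* Let the prior be the uniform distribution on $\mathcal{H}$ and let $H'\in\{1,\dots,H\}$. Among all posteriors with support a subset of $\mathcal{H}$ of size exactly $H'$, the best posterior $Q^{\ast}_{\mathrm{kl},\chi^2}(H')$ (i.e. the one minimizing the bound $r$) has its support on the ordered subset consisting of the smallest $H'$ values $\hat l_1\le\dots\le\hat l_{H'}$. A stationary point $Q^{\mathrm{FP}}_{\mathrm{kl},\chi^2}(H')$ of the KL-distance bound minimization problem can be obtained as the solution to the following fixed point equation in $\{q_i\}_{i=1}^{H'}$: $$q_i=\frac1{Z_{\mathrm{kl},\chi^2}}\left(\sum_{k=1}^{H'}q_k^2\right)\left\{1+\frac{\hat l_i-\sum_{k=1}^{H'}\hat l_kq_k}{\sqrt{\frac{H\left(\sum_{k=1}^{H'}q_k^2\right)\mathcal{I}^R_{\mathrm{kl}}(m,2)}{\delta}}}\ \ln\left(\frac{(1-r)\sum_{k=1}^{H'}\hat l_kq_k}{r\left(1-\sum_{k=1}^{H'}\hat l_kq_k\right)}\right)\right\},\quad i=1,\dots,H',$$ where $Z_{\mathrm{kl},\chi^2}$ is a suitable normalization constant (making $\sum_{i=1}^{H'}q_i=1$) and, for given $Q=(q_1,\dots,q_{H'})$ in the interior of $\Delta^{H'}$, $r\in(0,1)$ is the solution of $$kl\left(\sum_{k=1}^{H'}\hat l_kq_k,\,r\right)=\sqrt{\frac{H\left(\sum_{k=1}^{H'}q_k^2\right)\mathcal{I}^R_{\mathrm{kl}}(m,2)}{\delta}},\qquad r\ge\sum_{k=1}^{H'}\hat l_kq_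k.$$
   Context: $\mathcal{H}=\{h_1,\dots,h_H\}$ is a finite set of classifiers with empirical risks in $[0,1]$ indexed so that $\hat l_1\le\dots\le\hat l_H$; $m\ge1$ is an integer (sample size); $\delta\in(0,1)$; $\Delta^n=\{(q_1,\dots,q_n):q_i\ge0,\sum_iq_i=1\}$, whose interior is the set where all $q_i>0$. The support of a posterior $Q=(q_1,\dots,q_H)\in\Delta^H$ is $\{h_i:q_i>0\}$. Here $kl(a,b)=a\ln\frac ab+(1-a)\ln\frac{1-a}{1-b}$ and $\mathcal{I}^R_{\mathrm{kl}}(m,2)=\sup_{l\in[0,1]}\sum_{k=0}^m\binom mkl^k(1-l)^{m-k}\left(kl\left(\tfrac km,l\right)\right)^2$ (terms with zero binomial weight are $0$; $0\ln0=0$). The KL-distance bound minimization problem for the uniform prior is: minimize $r$ over $Q\in\Delta^H$ and $r\in(0,1)$ subject to $kl(\sum_i\hat l_iq_i,r)=\sqrt{H(\sum_iq_i^2)\mathcal{I}^R_{\mathrm{kl}}(m,2)/\delta}$ and $r\ge\sum_i\hat l_iq_i$. On posteriors with support $\{h_1,\dots,h_{H'}\}$, the variables are $q_1,\dots,q_{H'}>0$ and $r$; a stationary point is a feasible point satisfying the first-order KKT (Lagrange) conditions of this problem, the constraints $q_i\ge0$ ($i\le H'$) and $r\ge\sum_i\hat l_iq_i$ being inactive. The expressions are considered at points where $0<\sum_k\hat l_kq_k<1$. *)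

theory Defs
  imports Complex_Main
begin

text \<open>
  The classifiers \<open>h\<^sub>1, \<dots>, h\<^sub>H\<close> are represented by their indices \<open>1, \<dots>, H\<close>, with empirical risks
  \<open>l 1, \<dots>, l H\<close>. A tuple \<open>(q\<^sub>1, \<dots>, q\<^sub>n)\<close> is a function on \<open>nat\<close> vanishing outside \<open>{1..n}\<close>, so that
  \<open>prob_simplex n\<close> is literally contained in \<open>prob_simplex H\<close> for \<open>n \<le> H\<close> (extension by zero).
\<close>

definition prob_simplex :: "nat \<Rightarrow> (nat \<Rightarrow> real) set" where
  "prob_simplex n =
     {q. (\<forall>i\<in>{1..n}. 0 \<le> q i) \<and> (\<forall>i. i \<notin> {1..n} \<longrightarrow> q i = 0) \<and> (\<Sum>i=1..n. q i) = 1}"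

definition prob_simplex_interior :: "nat \<Rightarrow> (nat \<Rightarrow> real) set" where
  "prob_simplex_interior n = {q \<in> prob_simplex n. \<forall>i\<in>{1..n}. 0 < q i}"

definition support :: "nat \<Rightarrow> (nat \<Rightarrow> real) \<Rightarrow> nat set" where
  "support H q = {i \<in> {1..H}. 0 < q i}"

text \<open>
  The convention \<open>0 ln 0 = 0\<close> holds automatically. For \<open>b \<in> {0, 1}\<close> the value can differ from the usual
  \<open>\<infinity>\<close>; below, this only happens in terms with binomial weight zero.
\<close>

definition kl :: "real \<Rightarrow> real \<Rightarrow> real" where
  "kl a b = a * ln (a / b) + (1 - a) * ln ((1 - a) / (1 - b))"

text \<open>
  The set of values is bounded above, so the supremum in \<open>real\<close> is the genuine one.
\<close>

definition I_kl :: "nat \<Rightarrow> real" where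
  "I_kl m = (SUP l\<in>{0..1::real}.
     \<Sum>k=0..m. real (m choose k) * l ^ k * (1 - l) ^ (m - k) * (kl (real k / real m) l)\<^sup>2)"

definition mean_risk :: "(nat \<Rightarrow> real) \<Rightarrow> nat \<Rightarrow> (nat \<Rightarrow> real) \<Rightarrow> real" where
  "mean_risk l n q = (\<Sum>i=1..n. l i * q i)"

definition sum_sq :: "nat \<Rightarrow> (nat \<Rightarrow> real) \<Rightarrow> real" where
  "sum_sq n q = (\<Sum>i=1..n. (q i)\<^sup>2)"

text \<open>
  For the uniform prior the chi-squared term \<open>\<Sum> q\<^sub>i\<^sup>2 / p\<^sub>i\<close> equals \<open>H * \<Sum> q\<^sub>i\<^sup>2\<close>. The first argument is
  always the number of all classifiers, even when only the first \<open>n\<close> of them carry mass.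
\<close>

definition kl_radius :: "nat \<Rightarrow> nat \<Rightarrow> real \<Rightarrow> nat \<Rightarrow> (nat \<Rightarrow> real) \<Rightarrow> real" where
  "kl_radius H m \<delta> n q = sqrt (real H * sum_sq n q * I_kl m / \<delta>)"

definition solves_bound ::
    "nat \<Rightarrow> nat \<Rightarrow> real \<Rightarrow> (nat \<Rightarrow> real) \<Rightarrow> nat \<Rightarrow> (nat \<Rightarrow> real) \<Rightarrow> real \<Rightarrow> bool" where
  "solves_bound H m \<delta> l n q r \<longleftrightarrow>
     0 < r \<and> r < 1 \<and> kl (mean_risk l n q) r = kl_radius H m \<delta> n q \<and> r \<ge> mean_risk l n q"

definition feasible ::
    "nat \<Rightarrow> nat \<Rightarrow> real \<Rightarrow> (nat \<Rightarrow> real) \<Rightarrow> (nat \<Rightarrow> real) \<Rightarrow> real \<Rightarrow> bool" where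
  "feasible H m \<delta> l q r \<longleftrightarrow> q \<in> prob_simplex H \<and> solves_bound H m \<delta> l H q r"

definition best_posterior ::
    "nat \<Rightarrow> nat \<Rightarrow> real \<Rightarrow> (nat \<Rightarrow> real) \<Rightarrow> nat \<Rightarrow> (nat \<Rightarrow> real) \<Rightarrow> bool" where
  "best_posterior H m \<delta> l H' q \<longleftrightarrow>
     card (support H q) = H' \<and>
     (\<exists>r. feasible H m \<delta> l q r \<and>
        (\<forall>q' r'. feasible H m \<delta> l q' r' \<and> card (support H q') = H' \<longrightarrow> r \<le> r'))"

definition lagrangian ::
    "nat \<Rightarrow> nat \<Rightarrow> real \<Rightarrow> (nat \<Rightarrow> real) \<Rightarrow> real \<Rightarrow> real \<Rightarrow> (nat \<Rightarrow> real) \<Rightarrow> real \<Rightarrow> real" where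
  "lagrangian H m \<delta> l \<nu> \<mu> q r =
     r + \<nu> * (kl (mean_risk l H q) r - kl_radius H m \<delta> H q) + \<mu> * ((\<Sum>i=1..H. q i) - 1)"

text \<open>
  The inequality constraints \<open>q\<^sub>i \<ge> 0\<close> (\<open>i \<le> H'\<close>) and \<open>r \<ge> mean_risk\<close> are inactive, so by complementary
  slackness only the two equality constraints have multipliers. The variables are \<open>q\<^sub>1, \<dots>, q\<^bsub>H'\<^esub>\<close> and
  \<open>r\<close>; the remaining weights are fixed at \<open>0\<close>.
\<close>

definition stationary_point ::
    "nat \<Rightarrow> nat \<Rightarrow> real \<Rightarrow> (nat \<Rightarrow> real) \<Rightarrow> nat \<Rightarrow> (nat \<Rightarrow> real) \<Rightarrow> real \<Rightarrow> bool" where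
  "stationary_point H m \<delta> l H' q r \<longleftrightarrow>
     feasible H m \<delta> l q r \<and> support H q = {1..H'} \<and> mean_risk l H q < r \<and>
     (\<exists>\<nu> \<mu>.
        (\<forall>i\<in>{1..H'}.
           ((\<lambda>t. lagrangian H m \<delta> l \<nu> \<mu> (q(i := t)) r) has_real_derivative 0) (at (q i))) \<and>
        ((\<lambda>t. lagrangian H m \<delta> l \<nu> \<mu> q t) has_real_derivative 0) (at r))"

definition fp_weight ::
    "nat \<Rightarrow> nat \<Rightarrow> real \<Rightarrow> (nat \<Rightarrow> real) \<Rightarrow> nat \<Rightarrow> (nat \<Rightarrow> real) \<Rightarrow> real \<Rightarrow> nat \<Rightarrow> real" where
  "fp_weight H m \<delta> l H' q r i =
     sum_sq H' q *
       (1 + (l i - mean_risk l H' q) / kl_radius H m \<delta> H' q *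
            ln ((1 - r) * mean_risk l H' q / (r * (1 - mean_risk l H' q))))"

definition fp_normalizer ::
    "nat \<Rightarrow> nat \<Rightarrow> real \<Rightarrow> (nat \<Rightarrow> real) \<Rightarrow> nat \<Rightarrow> (nat \<Rightarrow> real) \<Rightarrow> real \<Rightarrow> real" where
  "fp_normalizer H m \<delta> l H' q r = (\<Sum>i=1..H'. fp_weight H m \<delta> l H' q r i)"

definition fixed_point ::
    "nat \<Rightarrow> nat \<Rightarrow> real \<Rightarrow> (nat \<Rightarrow> real) \<Rightarrow> nat \<Rightarrow> (nat \<Rightarrow> real) \<Rightarrow> real \<Rightarrow> bool" where
  "fixed_point H m \<delta> l H' q r \<longleftrightarrow>
     (\<forall>i\<in>{1..H'}. q i = 1 / fp_normalizer H m \<delta> l H' q r * fp_weight H m \<delta> l H' q r i)"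

end

theory Submission
  imports Defs "HOL-Library.Infinite_Set"
begin

text \<open>
  Everything about \<open>kl\<close> rests on one identity (\<open>kl_three_point\<close>): \<open>kl a r - kl a b - kl b r\<close> is linear
  in \<open>a - b\<close>, with the logarithm of the odds ratio of \<open>b\<close> and \<open>r\<close> as slope. Together with \<open>kl \<ge> 0\<close> it
  shows that for \<open>a \<le> r\<close> the divergence strictly increases in \<open>r\<close> and strictly decreases in \<open>a\<close>. Hence,
  for a fixed radius \<open>c > 0\<close>, the bound \<open>r > a\<close> solving \<open>kl a r = c\<close> exists, is unique, and is strictly
  increasing in the mean risk \<open>a\<close>. The radius is positive because \<open>I_kl m > 0\<close>; since \<open>I_kl\<close> is a
  supremum of reals, this requires that the set of values is bounded (\<open>I_kl_pos\<close>).

  Optimality of the first \<open>H'\<close> classifiers: move the weights of a posterior with support of size \<open>H'\<close>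
  in increasing order of index onto \<open>1, \<dots>, H'\<close> (\<open>sorted_rearrangement\<close>). The sum of squares, and hence
  the radius, is unchanged, and the mean risk does not increase, so the bound does not increase. If the
  bound was already optimal then the mean risk cannot have dropped, and as every moved weight is positive
  each moved risk must have been equal to the one it was replaced by.

  Fixed points: write \<open>A\<close> for the mean risk, \<open>c\<close> for the radius, \<open>s\<close> for the sum of squares and \<open>L\<close> for
  the slope \<open>\<partial>kl/\<partial>a\<close>, which is the logarithm in the fixed point equation. Stationarity in
  \<open>q\<^sub>i\<close> reads \<open>\<nu> (l\<^sub>i L - c q\<^sub>i / s) + \<mu> = 0\<close>, and stationarity in \<open>r\<close> determines a nonzero \<open>\<nu>\<close>.
  Weighting the former by \<open>q\<^sub>i\<close> and summing gives \<open>\<mu> / \<nu> = c - A L\<close>, so \<open>q\<^sub>i = s (1 + (l\<^sub>i - A) L / c)\<close>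
  (\<open>stationary_iff_weights\<close>). This is the fixed point equation with normalizer \<open>1\<close>; and the same
  weighted average shows that every solution of the fixed point equation has normalizer \<open>1\<close>
  (\<open>fixed_point_iff_weights\<close>).
\<close>

section \<open>The binary Kullback-Leibler divergence\<close>

text \<open>
  The inequality \<open>ln x < x - 1\<close> at \<open>x = b / a\<close>. Used for \<open>a, b\<close> and for \<open>1 - a, 1 - b\<close>, the two linear
  lower bounds cancel, which yields positivity of \<open>kl\<close>.
\<close>

lemma mult_ln_ratio_gt:
  fixes a b :: real
  assumes "0 \<le> a" "0 < b" "a \<noteq> b"
  shows "a - b < a * ln (a / b)"
proof (cases "a = 0")
  case False
  then have a: "a > 0" using assms by simp
  have "ln (b / a) < b / a - 1"
    using ln_le_minus_one[of "b / a"] ln_eq_minus_one[of "b / a"] a assms by force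
  then have "a * ln (b / a) < b - a"
    using a by (simp add: field_simps)
  moreover have "ln (a / b) = - ln (b / a)"
    using a assms by (simp add: ln_div)
  ultimately show ?thesis by simp
qed (use assms in simp)

lemma kl_expand:
  assumes "0 \<le> a" "a \<le> 1" "0 < b" "b < 1"
  shows "kl a b = a * ln a + (1 - a) * ln (1 - a) - a * ln b - (1 - a) * ln (1 - b)"
proof -
  have "a * ln (a / b) = a * ln a - a * ln b"
    using assms by (cases "a = 0") (auto simp: ln_div algebra_simps)
  moreover have "(1 - a) * ln ((1 - a) / (1 - b)) = (1 - a) * ln (1 - a) - (1 - a) * ln (1 - b)"
    using assms by (cases "a = 1") (auto simp: ln_div algebra_simps)
  ultimately show ?thesis by (simp add: kl_def)
qed

lemma kl_pos:
  assumes "0 \<le> a" "a \<le> 1" "0 < b" "b < 1" "a \<noteq> b"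
  shows "0 < kl a b"
  using mult_ln_ratio_gt[of a b] mult_ln_ratio_gt[of "1 - a" "1 - b"] assms
  by (simp add: kl_def)

lemma kl_self [simp]: "kl a a = 0"
  by (cases "a = 0"; cases "a = 1") (auto simp: kl_def)

text \<open>
  The law of cosines for the Bregman divergence of the negative entropy. The logarithm is the partial
  derivative of \<open>kl\<close> in its first argument at \<open>(b, r)\<close>; it has to be kept in this form because it is
  the one that occurs in the fixed point equation. The point \<open>a\<close> may be \<open>0\<close> or \<open>1\<close>, which spares the
  monotonicity proofs any limit argument at the boundary.
\<close>

lemma kl_three_point:
  assumes "0 \<le> a" "a \<le> 1" "0 < b" "b < 1" "0 < r" "r < 1"
  shows "kl a r = kl a b + kl b r + (a - b) * ln ((1 - r) * b / (r * (1 - b)))"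
proof -
  have slope: "ln ((1 - r) * b / (r * (1 - b))) = ln (1 - r) + ln b - ln r - ln (1 - b)"
    using assms by (simp add: ln_div ln_mult)
  show ?thesis
    unfolding slope using assms by (simp add: kl_expand) (simp add: algebra_simps)
qed

lemma kl_slope_neg:
  fixes b r :: real
  assumes "0 < b" "b < r" "r < 1"
  shows "ln ((1 - r) * b / (r * (1 - b))) < 0"
  using assms by (simp add: field_simps)

text \<open>
  Three-point identity with middle point \<open>r\<close>: both \<open>a - r\<close> and the slope are nonpositive.
\<close>

lemma kl_strict_mono_right:
  assumes "0 \<le> a" "a \<le> r" "0 < r" "r < s" "s < 1"
  shows "kl a r < kl a s"
proof -
  have "0 \<le> (a - r) * ln ((1 - s) * r / (s * (1 - r)))"
    using assms kl_slope_neg[of r s] by (intro mult_nonpos_nonpos) auto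
  moreover have "0 < kl r s"
    using assms by (intro kl_pos) auto
  ultimately show ?thesis
    using kl_three_point[of a r s] assms by simp
qed

text \<open>
  Three-point identity with middle point \<open>a\<close>, the point being moved to the left to \<open>a'\<close>.
\<close>

lemma kl_strict_antimono_left:
  assumes "0 \<le> a'" "a' < a" "a \<le> r" "r < 1"
  shows "kl a r < kl a' r"
proof -
  have "ln ((1 - r) * a / (r * (1 - a))) \<le> 0"
    using assms kl_slope_neg[of a r] by (cases "a = r") auto
  then have "0 \<le> (a' - a) * ln ((1 - r) * a / (r * (1 - a)))"
    using assms by (intro mult_nonpos_nonpos) auto
  moreover have "0 < kl a' a"
    using assms by (intro kl_pos) auto
  ultimately show ?thesis
    using kl_three_point[of a' a r] assms by simp
qed

text \<open>
  Intermediate value theorem between \<open>r = a\<close>, where \<open>kl\<close> vanishes, and a point \<open>s\<close> close to \<open>1\<close> where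
  it has reached \<open>c\<close>. The endpoint \<open>s\<close> is chosen such that \<open>(1 - a) / (1 - s) = exp X\<close>; then the second
  summand of \<open>kl a s\<close> is \<open>(1 - a) X\<close>, while the first is at least \<open>a ln a\<close>, which dictates \<open>X\<close>.
\<close>

lemma kl_upper_inverse_exists:
  assumes a: "0 \<le> a" "a < 1" and c: "0 < c"
  shows "\<exists>r. a < r \<and> r < 1 \<and> kl a r = c"
proof -
  define X where "X = (c - a * ln a) / (1 - a)"
  define s where "s = 1 - (1 - a) * exp (- X)"
  have a_ln: "a * ln a \<le> 0"
    using a by (cases "a = 0") (auto simp: mult_le_0_iff)
  have X: "0 < X" using a c a_ln by (simp add: X_def)
  have s: "a < s" "s < 1"
  proof -
    have "(1 - a) * exp (- X) < (1 - a) * 1"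
      using a X by (intro mult_strict_left_mono) auto
    then show "a < s" by (simp add: s_def)
    show "s < 1" using a by (simp add: s_def)
  qed
  have "a * ln a \<le> a * ln (a / s)"
    using a s by (cases "a = 0") (auto simp: ln_div)
  moreover have "(1 - a) * ln ((1 - a) / (1 - s)) = c - a * ln a"
  proof -
    have "(1 - a) / (1 - s) = exp X"
      using a by (simp add: s_def exp_minus field_simps)
    then show ?thesis using a by (simp add: X_def)
  qed
  ultimately have ge: "c \<le> kl a s" by (simp add: kl_def)
  \<comment> \<open>For \<open>a = 0\<close> the interval contains \<open>0\<close>, where \<open>ln (a / r)\<close> divides by zero; but there the
      summand has the factor \<open>0\<close>.\<close>
  have cont: "continuous_on {a..s} (kl a)"
  proof (cases "a = 0")
    case True
    then show ?thesis
      unfolding kl_def using s by (auto intro!: continuous_intros)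
  next
    case False
    then show ?thesis
      unfolding kl_def using a s by (auto intro!: continuous_intros)
  qed
  obtain r where r: "a \<le> r" "r \<le> s" "kl a r = c"
    using IVT'[of "kl a" a c s] ge c s cont by auto
  then have "r \<noteq> a" using c by auto
  with r s show ?thesis by (intro exI[of _ r]) auto
qed

text \<open>
  If the bound \<open>r'\<close> of the smaller risk exceeded \<open>r\<close>, then \<open>kl a r \<le> kl a' r < kl a' r'\<close>, contradicting
  equality of the radii.
\<close>

lemma kl_upper_inverse_mono:
  assumes "0 \<le> a'" "a' \<le> a" "a \<le> r" "0 < r" "r < 1" "a' \<le> r'" "r' < 1"
    and eq: "kl a' r' = kl a r"
  shows "r' \<le> r" and "a' < a \<Longrightarrow> r' < r"
proof -
  have le: "kl a r \<le> kl a' r"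
    using assms kl_strict_antimono_left[of a' a r] by (cases "a' = a") auto
  show *: "r' \<le> r"
  proof (rule ccontr)
    assume "\<not> r' \<le> r"
    then have "kl a' r < kl a' r'"
      using assms by (intro kl_strict_mono_right) auto
    then show False using le eq by simp
  qed
  show "r' < r" if "a' < a"
  proof -
    have "kl a r < kl a' r"
      using that assms by (intro kl_strict_antimono_left) auto
    then show ?thesis using * eq by (cases "r' = r") auto
  qed
qed

section \<open>Positivity of the radius\<close>

text \<open>
  With \<open>s = sqrt x\<close> the left-hand side is \<open>4 (s ln s)\<^sup>2\<close>, and \<open>\<bar>s ln s\<bar> \<le> 1\<close>. This is the bound that
  lets a single factor \<open>x\<close> absorb the logarithmic singularity of \<open>kl\<close> at the ends of the unit interval.
\<close>

lemma mult_ln_squared_le: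
  fixes x :: real
  assumes "0 \<le> x" "x \<le> 1"
  shows "x * (ln x)\<^sup>2 \<le> 4"
proof (cases "x = 0")
  case False
  define s where "s = sqrt x"
  have s: "0 < s" "s \<le> 1" "x = s\<^sup>2"
    using assms False by (auto simp: s_def)
  have "ln (1 / s) \<le> 1 / s - 1"
    using s by (intro ln_le_minus_one) simp
  then have "- ln s \<le> 1 / s - 1" using s by (simp add: ln_div)
  then have "s * (- ln s) \<le> 1"
    using s by (simp add: field_simps)
  moreover have "0 \<le> s * (- ln s)"
    using s by (intro mult_nonneg_nonneg) auto
  ultimately have "(s * (- ln s))\<^sup>2 \<le> 1\<^sup>2"
    by (intro power_mono)
  moreover have "x * (ln x)\<^sup>2 = 4 * (s * (- ln s))\<^sup>2"
    using s by (simp add: ln_realpow power_mult_distrib)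
  ultimately show ?thesis by simp
qed simp

lemma square_add3_le:
  fixes x y z :: real
  shows "(x + y + z)\<^sup>2 \<le> 3 * (x\<^sup>2 + y\<^sup>2 + z\<^sup>2)"
proof -
  have "0 \<le> (x - y)\<^sup>2 + (y - z)\<^sup>2 + (x - z)\<^sup>2" by simp
  then show ?thesis by (simp add: power2_eq_square algebra_simps)
qed

lemma power_mult_ln_squared_le:
  fixes x a :: real
  assumes "0 \<le> x" "x \<le> 1" "0 \<le> a" "a \<le> 1" and "n = 0 \<Longrightarrow> a = 0"
  shows "x ^ n * (a * ln x)\<^sup>2 \<le> 4"
proof (cases n)
  case 0
  then show ?thesis using assms by simp
next
  case (Suc k)
  have "x ^ n * (a * ln x)\<^sup>2 = (x ^ k * a\<^sup>2) * (x * (ln x)\<^sup>2)"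
    by (simp add: Suc power_mult_distrib)
  also have "\<dots> \<le> 1 * 4"
    using assms mult_ln_squared_le[of x]
    by (intro mult_mono mult_le_one power_le_one) auto
  finally show ?thesis by simp
qed

text \<open>
  Up to a constant, \<open>kl a x\<close> is \<open>- a ln x - (1 - a) ln (1 - x)\<close>. If \<open>a = k / m\<close> is positive then
  \<open>k \<ge> 1\<close>, so the binomial weight provides a factor \<open>x\<close> whenever \<open>ln x\<close> is present; symmetrically for
  \<open>1 - x\<close>.
\<close>

lemma binomial_kl_term_le:
  fixes x :: real
  assumes x: "0 \<le> x" "x \<le> 1" and k: "k \<le> m" and m: "1 \<le> m"
  defines "a \<equiv> real k / real m"
  shows "x ^ k * (1 - x) ^ (m - k) * (kl a x)\<^sup>2
           \<le> 3 * ((a * ln a + (1 - a) * ln (1 - a))\<^sup>2 + 8)"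
proof (cases "x = 0 \<or> x = 1")
  case True
  have a: "0 \<le> a" "a \<le> 1" using k m by (auto simp: a_def)
  have "x ^ k * (1 - x) ^ (m - k) * (kl a x)\<^sup>2 = 0"
  proof (cases "k = 0 \<or> k = m")
    case False
    \<comment> \<open>Both powers have a positive exponent, and one of the bases is \<open>0\<close>.\<close>
    with True k show ?thesis by auto
  next
    case ends: True
    \<comment> \<open>Now \<open>a\<close> is \<open>0\<close> or \<open>1\<close>: either \<open>a = x\<close> and \<open>kl\<close> vanishes, or the weight does.\<close>
    show ?thesis
      using True ends m k by (auto simp: a_def kl_def)
  qed
  then show ?thesis by (simp only:) simp
next
  case False
  then have x': "0 < x" "x < 1" using x by auto
  have a: "0 \<le> a" "a \<le> 1" using k m by (auto simp: a_def)
  let ?h = "a * ln a + (1 - a) * ln (1 - a)"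
  let ?w = "x ^ k * (1 - x) ^ (m - k)"
  have le1: "x ^ k \<le> 1" "(1 - x) ^ (m - k) \<le> 1"
    using x by (auto intro!: power_le_one)
  have w: "0 \<le> ?w" "?w \<le> 1"
    using x le1 by (auto intro: mult_le_one)
  have t1: "?w * ?h\<^sup>2 \<le> 1 * ?h\<^sup>2"
    using w by (intro mult_right_mono) auto
  have t2: "?w * (- (a * ln x))\<^sup>2 \<le> 4"
  proof -
    have "?w * (- (a * ln x))\<^sup>2 = (1 - x) ^ (m - k) * (x ^ k * (a * ln x)\<^sup>2)" by simp
    also have "\<dots> \<le> 1 * 4"
      using le1 x a by (intro mult_mono power_mult_ln_squared_le) (auto simp: a_def)
    finally show ?thesis by simp
  qed
  have t3: "?w * (- ((1 - a) * ln (1 - x)))\<^sup>2 \<le> 4"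
  proof -
    have "?w * (- ((1 - a) * ln (1 - x)))\<^sup>2
        = x ^ k * ((1 - x) ^ (m - k) * ((1 - a) * ln (1 - x))\<^sup>2)" by simp
    also have "\<dots> \<le> 1 * 4"
      using le1 x a k m by (intro mult_mono power_mult_ln_squared_le) (auto simp: a_def)
    finally show ?thesis by simp
  qed
  have "kl a x = ?h + - (a * ln x) + - ((1 - a) * ln (1 - x))"
    using kl_expand[of a x] a x' by simp
  then have "(kl a x)\<^sup>2
      \<le> 3 * (?h\<^sup>2 + (- (a * ln x))\<^sup>2 + (- ((1 - a) * ln (1 - x)))\<^sup>2)"
    using square_add3_le by presburger
  then have "?w * (kl a x)\<^sup>2
      \<le> ?w * (3 * (?h\<^sup>2 + (- (a * ln x))\<^sup>2 + (- ((1 - a) * ln (1 - x)))\<^sup>2))"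
    using w by (intro mult_left_mono) auto
  also have "\<dots> = 3 * (?w * ?h\<^sup>2 + ?w * (- (a * ln x))\<^sup>2
      + ?w * (- ((1 - a) * ln (1 - x)))\<^sup>2)"
    by (simp only: algebra_simps)
  also have "\<dots> \<le> 3 * (1 * ?h\<^sup>2 + 4 + 4)"
    by (intro mult_left_mono add_mono t1 t2 t3) simp
  finally show ?thesis by simp
qed

text \<open>
  The supremum of a set bounded above exceeds the value at \<open>1/2\<close>, where already the summand \<open>k = 0\<close> is
  positive.
\<close>

lemma I_kl_pos:
  assumes m: "1 \<le> m"
  shows "0 < I_kl m"
proof -
  let ?F = "\<lambda>x::real. \<Sum>k=0..m. real (m choose k) * x ^ k * (1 - x) ^ (m - k) * (kl (real k / real m) x)\<^sup>2"
  let ?h = "\<lambda>a::real. a * ln a + (1 - a) * ln (1 - a)"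
  have "bdd_above (?F ` {0..1})"
  proof (intro bdd_aboveI2)
    fix x :: real assume x: "x \<in> {0..1}"
    show "?F x \<le> (\<Sum>k=0..m. real (m choose k) * (3 * ((?h (real k / real m))\<^sup>2 + 8)))"
    proof (intro sum_mono)
      fix k assume "k \<in> {0..m}"
      then have "x ^ k * (1 - x) ^ (m - k) * (kl (real k / real m) x)\<^sup>2
           \<le> 3 * ((?h (real k / real m))\<^sup>2 + 8)"
        using binomial_kl_term_le[of x k m] x m by auto
      then have "real (m choose k) * (x ^ k * (1 - x) ^ (m - k) * (kl (real k / real m) x)\<^sup>2)
           \<le> real (m choose k) * (3 * ((?h (real k / real m))\<^sup>2 + 8))"
        by (intro mult_left_mono) auto
      then show "real (m choose k) * x ^ k * (1 - x) ^ (m - k) * (kl (real k / real m) x)\<^sup>2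
           \<le> real (m choose k) * (3 * ((?h (real k / real m))\<^sup>2 + 8))"
        by (simp only: mult.assoc)
    qed
  qed
  then have "?F (1/2) \<le> I_kl m"
    unfolding I_kl_def by (intro cSUP_upper) auto
  moreover have "0 < ?F (1/2)"
  proof (rule sum_pos2[where i = 0])
    have "0 < kl 0 (1/2)" by (intro kl_pos) auto
    then show "0 < real (m choose 0) * (1/2) ^ 0 * (1 - 1/2) ^ (m - 0) * (kl (real 0 / real m) (1/2))\<^sup>2"
      by simp
  qed auto
  ultimately show ?thesis by simp
qed

lemma sum_sq_pos:
  assumes "q \<in> prob_simplex n"
  shows "0 < sum_sq n q"
proof -
  have "\<not> (\<forall>i\<in>{1..n}. q i = 0)"
  proof
    assume "\<forall>i\<in>{1..n}. q i = 0"
    then have "(\<Sum>i=1..n. q i) = 0" by simp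
    then show False using assms by (simp add: prob_simplex_def)
  qed
  then obtain i where "i \<in> {1..n}" "q i \<noteq> 0" by blast
  then show ?thesis
    unfolding sum_sq_def by (intro sum_pos2[of _ i]) auto
qed

lemma kl_radius_pos:
  assumes "1 \<le> H" "1 \<le> m" "0 < \<delta>" "q \<in> prob_simplex n"
  shows "0 < kl_radius H m \<delta> n q"
  using assms sum_sq_pos[of q n] I_kl_pos[of m] by (simp add: kl_radius_def)

lemma mean_risk_nonneg:
  assumes "\<forall>i\<in>{1..n}. 0 \<le> l i" "q \<in> prob_simplex n"
  shows "0 \<le> mean_risk l n q"
  using assms by (auto simp: mean_risk_def prob_simplex_def intro!: sum_nonneg)

section \<open>The bound as a function of the posterior\<close>

lemma solves_bound_exists:
  assumes "0 \<le> mean_risk l n q" "mean_risk l n q < 1" "0 < kl_radius H m \<delta> n q"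
  obtains r where "solves_bound H m \<delta> l n q r"
  using kl_upper_inverse_exists[OF assms] assms by (force simp: solves_bound_def)

text \<open>
  Only the radius and the mean risk matter, so the posteriors may live on different index ranges. With
  equal mean risks the lemma gives uniqueness of the bound.
\<close>

lemma solves_bound_compare:
  assumes "solves_bound H m \<delta> l n q r" "solves_bound H m \<delta> l n' q' r'"
    and "kl_radius H m \<delta> n' q' = kl_radius H m \<delta> n q"
    and "0 \<le> mean_risk l n' q'" "mean_risk l n' q' \<le> mean_risk l n q"
  shows "r' \<le> r" and "mean_risk l n' q' < mean_risk l n q \<Longrightarrow> r' < r"
  using assms kl_upper_inverse_mono[of "mean_risk l n' q'" "mean_risk l n q" r r']
  by (auto simp: solves_bound_def)

section \<open>Moving the support to the smallest risks\<close>

text \<open>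
  The map \<open>\<sigma>\<close> enumerates the support in increasing order. Then \<open>i \<le> \<sigma> i\<close>, since the first \<open>i\<close> elements of
  the support are distinct positive indices, and so \<open>l i \<le> l (\<sigma> i)\<close>. The posterior \<open>q'\<close> gives index \<open>i\<close>
  the weight \<open>q (\<sigma> i)\<close>. The decrease of the mean risk is stated as an exact sum, since its vanishing must
  later force every summand to vanish.
\<close>

lemma sorted_rearrangement:
  assumes mono: "mono_on {1..H} l" and q: "q \<in> prob_simplex H"
    and card: "card (support H q) = n"
  obtains \<sigma> q' where "bij_betw \<sigma> {1..n} (support H q)"
    and "\<And>i. i \<in> {1..n} \<Longrightarrow> l i \<le> l (\<sigma> i)"
    and "q' \<in> prob_simplex H" and "support H q' = {1..n}"
    and "sum_sq H q' = sum_sq H q"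
    and "mean_risk l H q - mean_risk l H q' = (\<Sum>i=1..n. (l (\<sigma> i) - l i) * q (\<sigma> i))"
proof -
  have fin: "finite (support H q)" by (simp add: support_def)
  have sub: "support H q \<subseteq> {1..H}" by (auto simp: support_def)
  obtain h where h: "bij_betw h {..<n} (support H q)" "strict_mono_on {..<n} h"
    by (rule ex_bij_betw_strict_mono_card[OF fin, unfolded card])
  define \<sigma> where "\<sigma> = (\<lambda>i. h (i - 1))"
  have "bij_betw (\<lambda>i::nat. i - 1) {1..n} {..<n}"
    by (rule bij_betw_byWitness[where f' = Suc]) auto
  from bij_betw_trans[OF this h(1)] have bij: "bij_betw \<sigma> {1..n} (support H q)"
    by (simp add: \<sigma>_def comp_def)
  have in_supp: "\<sigma> i \<in> support H q" if "i \<in> {1..n}" for i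
    using bij that by (auto simp: bij_betw_def)
  \<comment> \<open>\<open>h\<close> enumerates from \<open>0\<close> while classifiers are numbered from \<open>1\<close>, hence the shift by one.\<close>
  have ge: "Suc j \<le> h j" if "j < n" for j
    using that
  proof (induction j)
    case 0
    then have "h 0 \<in> support H q" using h(1) by (auto simp: bij_betw_def)
    then show ?case using sub by auto
  next
    case (Suc j)
    have "h j < h (Suc j)"
      using strict_mono_onD[OF h(2)] Suc.prems by simp
    with Suc show ?case by simp
  qed
  have "n \<le> H"
    using card card_mono[OF _ sub] by simp
  have l_le: "l i \<le> l (\<sigma> i)" if i: "i \<in> {1..n}" for i
  proof (rule mono_onD[OF mono])
    show "i \<le> \<sigma> i" using ge[of "i - 1"] i by (auto simp: \<sigma>_def)
    show "\<sigma> i \<in> {1..H}" using in_supp[OF i] sub by auto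
    show "i \<in> {1..H}" using i \<open>n \<le> H\<close> by auto
  qed
  define q' where "q' = (\<lambda>i. if i \<in> {1..n} then q (\<sigma> i) else 0)"
  have outside: "q i = 0" if "i \<in> {1..H} - support H q" for i
    using that q by (force simp: support_def prob_simplex_def)
  have transfer: "(\<Sum>i=1..H. f i (q i)) = (\<Sum>i=1..n. f (\<sigma> i) (q (\<sigma> i)))"
    if "\<And>i. f i 0 = 0" for f :: "nat \<Rightarrow> real \<Rightarrow> real"
  proof -
    have "(\<Sum>i=1..H. f i (q i)) = (\<Sum>i\<in>support H q. f i (q i))"
      using outside that sub by (intro sum.mono_neutral_right) auto
    also have "\<dots> = (\<Sum>i=1..n. f (\<sigma> i) (q (\<sigma> i)))"
      by (rule sum.reindex_bij_betw[OF bij, symmetric])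
    finally show ?thesis .
  qed
  have transfer': "(\<Sum>i=1..H. f i (q' i)) = (\<Sum>i=1..n. f i (q (\<sigma> i)))"
    if "\<And>i. f i 0 = 0" for f :: "nat \<Rightarrow> real \<Rightarrow> real"
  proof -
    have "(\<Sum>i=1..H. f i (q' i)) = (\<Sum>i=1..n. f i (q' i))"
      using \<open>n \<le> H\<close> that by (intro sum.mono_neutral_right) (auto simp: q'_def)
    then show ?thesis by (simp add: q'_def)
  qed
  have pos: "0 < q (\<sigma> i)" if "i \<in> {1..n}" for i
    using in_supp[OF that] by (simp add: support_def)
  show ?thesis
  proof (rule that[OF bij l_le])
    have "(\<Sum>i=1..H. q' i) = 1"
      using transfer[of "\<lambda>_ x. x"] transfer'[of "\<lambda>_ x. x"] q by (simp add: prob_simplex_def)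
    then show "q' \<in> prob_simplex H"
      using pos \<open>n \<le> H\<close> by (auto simp: prob_simplex_def q'_def intro: less_imp_le)
    show "support H q' = {1..n}"
      using pos \<open>n \<le> H\<close> by (auto simp: support_def q'_def)
    show "sum_sq H q' = sum_sq H q"
      using transfer[of "\<lambda>_ x. x\<^sup>2"] transfer'[of "\<lambda>_ x. x\<^sup>2"] by (simp add: sum_sq_def)
    show "mean_risk l H q - mean_risk l H q' = (\<Sum>i=1..n. (l (\<sigma> i) - l i) * q (\<sigma> i))"
      using transfer[of "\<lambda>i x. l i * x"] transfer'[of "\<lambda>i x. l i * x"]
      by (simp add: mean_risk_def sum_subtractf algebra_simps)
  qed
qed

section \<open>Derivatives of the Lagrangian\<close>

lemma mult_ln_ratio_has_derivative:
  fixes a b :: real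
  assumes "0 < a" "0 < b"
  shows "((\<lambda>x. x * ln (x / b)) has_real_derivative ln (a / b) + 1) (at a)"
    and "((\<lambda>x. a * ln (a / x)) has_real_derivative - a / b) (at b)"
  using assms by (auto intro!: derivative_eq_intros simp: power2_eq_square)

lemma kl_has_derivative_left:
  assumes "0 < a" "a < 1" "0 < r" "r < 1"
  shows "((\<lambda>x. kl x r) has_real_derivative ln ((1 - r) * a / (r * (1 - a)))) (at a)"
proof -
  have "((\<lambda>x. (1 - x) * ln ((1 - x) / (1 - r))) has_real_derivative
          (ln ((1 - a) / (1 - r)) + 1) * (- 1)) (at a)"
    by (rule DERIV_chain2[where g = "\<lambda>x. 1 - x", OF mult_ln_ratio_has_derivative(1)])
       (use assms in \<open>auto intro!: derivative_eq_intros\<close>)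
  from DERIV_add[OF mult_ln_ratio_has_derivative(1) this]
  have "((\<lambda>x. kl x r) has_real_derivative
          (ln (a / r) + 1) + (ln ((1 - a) / (1 - r)) + 1) * (- 1)) (at a)"
    using assms by (simp add: kl_def)
  moreover have "(ln (a / r) + 1) + (ln ((1 - a) / (1 - r)) + 1) * (- 1)
      = ln ((1 - r) * a / (r * (1 - a)))"
    using assms by (simp add: ln_div ln_mult)
  ultimately show ?thesis by simp
qed

lemma kl_has_derivative_right:
  assumes "0 < a" "a < 1" "0 < r" "r < 1"
  shows "(kl a has_real_derivative (r - a) / (r * (1 - r))) (at r)"
proof -
  have "((\<lambda>x. (1 - a) * ln ((1 - a) / (1 - x))) has_real_derivative
          (- (1 - a) / (1 - r)) * (- 1)) (at r)"
    by (rule DERIV_chain2[where g = "\<lambda>x. 1 - x", OF mult_ln_ratio_has_derivative(2)])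
       (use assms in \<open>auto intro!: derivative_eq_intros\<close>)
  from DERIV_add[OF mult_ln_ratio_has_derivative(2) this]
  have "(kl a has_real_derivative - a / r + (- (1 - a) / (1 - r)) * (- 1)) (at r)"
    using assms by (simp add: kl_def[abs_def])
  moreover have "- a / r + (- (1 - a) / (1 - r)) * (- 1) = (r - a) / (r * (1 - r))"
    using assms by (simp add: divide_simps) (simp add: algebra_simps)
  ultimately show ?thesis by simp
qed

lemma sum_upd_has_derivative:
  fixes f :: "nat \<Rightarrow> real \<Rightarrow> real"
  assumes "i \<in> {1..n}" "(f i has_real_derivative D) (at (q i))"
  shows "((\<lambda>t. \<Sum>j=1..n. f j ((q(i := t)) j)) has_real_derivative D) (at (q i))"
proof -
  have "(\<Sum>j=1..n. f j ((q(i := t)) j)) = f i t + (\<Sum>j\<in>{1..n}-{i}. f j (q j))" for t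
  proof -
    have "(\<Sum>j=1..n. f j ((q(i := t)) j)) = f i t + (\<Sum>j\<in>{1..n}-{i}. f j ((q(i := t)) j))"
      using assms(1) by (subst sum.remove[of "{1..n}" i]) auto
    also have "(\<Sum>j\<in>{1..n}-{i}. f j ((q(i := t)) j)) = (\<Sum>j\<in>{1..n}-{i}. f j (q j))"
      by (intro sum.cong) auto
    finally show ?thesis .
  qed
  then show ?thesis
    using assms(2) by (auto intro!: derivative_eq_intros)
qed

text \<open>
  As the radius is the square root of a multiple of the sum of squares \<open>s\<close>, its derivative in \<open>q\<^sub>i\<close> is
  the radius times \<open>q\<^sub>i / s\<close>.
\<close>

lemma lagrangian_weight_derivative:
  assumes i: "i \<in> {1..H}" and a: "0 < mean_risk l H q" "mean_risk l H q < 1"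
    and r: "0 < r" "r < 1" and c: "0 < kl_radius H m \<delta> H q"
  shows "((\<lambda>t. lagrangian H m \<delta> l \<nu> \<mu> (q(i := t)) r) has_real_derivative
           \<nu> * (l i * ln ((1 - r) * mean_risk l H q / (r * (1 - mean_risk l H q)))
                - kl_radius H m \<delta> H q * q i / sum_sq H q) + \<mu>) (at (q i))"
proof -
  let ?a = "mean_risk l H q" and ?c = "kl_radius H m \<delta> H q" and ?s = "sum_sq H q"
  let ?L = "ln ((1 - r) * ?a / (r * (1 - ?a)))"
  define K where "K = real H * I_kl m / \<delta>"
  have radius: "kl_radius H m \<delta> H p = sqrt (K * sum_sq H p)" for p
    by (simp add: kl_radius_def K_def mult_ac)
  have Ks: "0 < K * ?s" using c by (simp add: radius)
  have mean: "((\<lambda>t. mean_risk l H (q(i := t))) has_real_derivative l i) (at (q i))"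
    unfolding mean_risk_def
    by (rule sum_upd_has_derivative[where f = "\<lambda>j x. l j * x", OF i])
       (auto intro!: derivative_eq_intros)
  have sq: "((\<lambda>t. sum_sq H (q(i := t))) has_real_derivative 2 * q i) (at (q i))"
    unfolding sum_sq_def
    by (rule sum_upd_has_derivative[where f = "\<lambda>j x. x\<^sup>2", OF i])
       (auto intro!: derivative_eq_intros)
  have mass: "((\<lambda>t. \<Sum>j=1..H. (q(i := t)) j) has_real_derivative 1) (at (q i))"
    by (rule sum_upd_has_derivative[where f = "\<lambda>j x. x", OF i])
       (auto intro!: derivative_eq_intros)
  have div: "((\<lambda>t. kl (mean_risk l H (q(i := t))) r) has_real_derivative ?L * l i) (at (q i))"
    using DERIV_chain2[OF _ mean, of "\<lambda>x. kl x r" ?L] kl_has_derivative_left[OF a r] by simp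
  have rad: "((\<lambda>t. kl_radius H m \<delta> H (q(i := t))) has_real_derivative ?c * q i / ?s) (at (q i))"
  proof -
    have "((\<lambda>t. sqrt (K * sum_sq H (q(i := t)))) has_real_derivative
            K * (2 * q i) * (inverse (sqrt (K * ?s)) / 2)) (at (q i))"
      using Ks by (auto intro!: derivative_eq_intros sq)
    moreover have "K * (2 * q i) * (inverse (sqrt (K * ?s)) / 2) = ?c * q i / ?s"
    proof -
      have "?c * ?c = K * ?s" using Ks by (simp add: radius)
      then have "K = ?c * ?c / ?s" using Ks by auto
      then show ?thesis using c by (simp add: radius[symmetric])
    qed
    ultimately show ?thesis by (simp add: radius)
  qed
  have "((\<lambda>t. lagrangian H m \<delta> l \<nu> \<mu> (q(i := t)) r) has_real_derivative
          0 + \<nu> * (?L * l i - ?c * q i / ?s) + \<mu> * (1 - 0)) (at (q i))"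
    unfolding lagrangian_def
    by (intro DERIV_add DERIV_const DERIV_cmult DERIV_diff div rad mass)
  then show ?thesis by (simp add: mult.commute)
qed

lemma lagrangian_bound_derivative:
  assumes "0 < mean_risk l H q" "mean_risk l H q < 1" "0 < r" "r < 1"
  shows "((\<lambda>t. lagrangian H m \<delta> l \<nu> \<mu> q t) has_real_derivative
           1 + \<nu> * ((r - mean_risk l H q) / (r * (1 - r)))) (at r)"
  unfolding lagrangian_def
  by (auto intro!: derivative_eq_intros kl_has_derivative_right[OF assms])

section \<open>Fixed points and stationary points\<close>

text \<open>
  The \<open>q\<close>-weighted sum of the unnormalized weights is exactly \<open>s = sum_sq n q\<close>, because the deviations
  \<open>l\<^sub>i - A\<close> from the mean risk average to zero. Multiplying the fixed point equation by \<open>q\<^sub>i\<close> and summing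
  therefore gives \<open>s = s / Z\<close>, which forces \<open>Z = 1\<close>.
\<close>

lemma fixed_point_iff_weights:
  assumes q: "q \<in> prob_simplex_interior n"
  shows "fixed_point H m \<delta> l n q r \<longleftrightarrow> (\<forall>i\<in>{1..n}. q i = fp_weight H m \<delta> l n q r i)"
proof -
  let ?w = "fp_weight H m \<delta> l n q r" and ?Z = "fp_normalizer H m \<delta> l n q r"
  have simplex: "q \<in> prob_simplex n" and total: "(\<Sum>i=1..n. q i) = 1"
    using q by (auto simp: prob_simplex_interior_def prob_simplex_def)
  have s: "0 < sum_sq n q" by (rule sum_sq_pos[OF simplex])
  show ?thesis
  proof
    assume eq: "\<forall>i\<in>{1..n}. q i = ?w i"
    then have "?Z = 1" using total by (simp add: fp_normalizer_def)
    then show "fixed_point H m \<delta> l n q r" using eq by (simp add: fixed_point_def)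
  next
    assume fp: "fixed_point H m \<delta> l n q r"
    define T where "T = ln ((1 - r) * mean_risk l n q / (r * (1 - mean_risk l n q)))
       / kl_radius H m \<delta> n q"
    have w: "?w i = sum_sq n q * (1 + (l i - mean_risk l n q) * T)" for i
      by (simp add: fp_weight_def T_def)
    have "(\<Sum>i=1..n. q i * ?w i)
        = sum_sq n q * ((\<Sum>i=1..n. q i) + ((\<Sum>i=1..n. l i * q i)
            - mean_risk l n q * (\<Sum>i=1..n. q i)) * T)"
      unfolding w by (simp add: sum_distrib_left sum_distrib_right sum.distrib
          sum_subtractf algebra_simps)
    also have "\<dots> = sum_sq n q"
      unfolding total by (simp add: mean_risk_def)
    finally have avg: "(\<Sum>i=1..n. q i * ?w i) = sum_sq n q" .
    have "sum_sq n q = (\<Sum>i=1..n. q i * (1 / ?Z * ?w i))"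
      unfolding sum_sq_def power2_eq_square
      using fp by (intro sum.cong) (auto simp: fixed_point_def)
    also have "\<dots> = 1 / ?Z * (\<Sum>i=1..n. q i * ?w i)"
      by (simp add: sum_distrib_left mult_ac)
    \<comment> \<open>For \<open>?Z = 0\<close> the quotient would be \<open>0\<close>, contradicting positivity of the sum of squares.\<close>
    finally have "?Z = 1"
      using s avg by (cases "?Z = 0") (auto simp: field_simps)
    then show "\<forall>i\<in>{1..n}. q i = ?w i"
      using fp by (simp add: fixed_point_def)
  qed
qed

lemma prob_simplex_extend:
  assumes "q \<in> prob_simplex n" "n \<le> H"
  shows "q \<in> prob_simplex H" "mean_risk l H q = mean_risk l n q" "sum_sq H q = sum_sq n q"
proof -
  have zero: "q i = 0" if "i \<notin> {1..n}" for i
    using assms that by (simp add: prob_simplex_def)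
  have ext: "(\<Sum>i=1..H. f i (q i)) = (\<Sum>i=1..n. f i (q i))" if "\<And>i. f i 0 = 0"
    for f :: "nat \<Rightarrow> real \<Rightarrow> real"
    using assms(2) zero that by (intro sum.mono_neutral_right) auto
  show "mean_risk l H q = mean_risk l n q" "sum_sq H q = sum_sq n q"
    using ext[of "\<lambda>i x. l i * x"] ext[of "\<lambda>i x. x\<^sup>2"] by (auto simp: mean_risk_def sum_sq_def)
  have "0 \<le> q i" for i
    using assms(1) zero[of i] by (cases "i \<in> {1..n}") (auto simp: prob_simplex_def)
  then show "q \<in> prob_simplex H"
    using ext[of "\<lambda>_ x. x"] assms zero by (auto simp: prob_simplex_def)
qed

text \<open>
  Eliminating the multipliers. At a point with \<open>A < r\<close> the derivative of \<open>kl\<close> in \<open>r\<close> is positive, so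
  stationarity in \<open>r\<close> fixes \<open>\<nu> \<noteq> 0\<close> and leaves only \<open>\<mu> / \<nu>\<close> in the equations for the weights; that
  quotient is found by averaging these equations with weights \<open>q\<^sub>i\<close>. For the converse the same values serve
  as multipliers.
\<close>

lemma stationary_iff_weights:
  assumes q: "q \<in> prob_simplex_interior n" and n: "1 \<le> n" "n \<le> H"
    and a: "0 < mean_risk l n q" "mean_risk l n q < 1"
    and c: "0 < kl_radius H m \<delta> n q"
  shows "stationary_point H m \<delta> l n q r \<longleftrightarrow>
           solves_bound H m \<delta> l n q r \<and> (\<forall>i\<in>{1..n}. q i = fp_weight H m \<delta> l n q r i)"
proof -
  have simplex: "q \<in> prob_simplex n" and pos: "\<And>i. i \<in> {1..n} \<Longrightarrow> 0 < q i"
    and total: "(\<Sum>i=1..n. q i) = 1"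
    using q by (auto simp: prob_simplex_interior_def prob_simplex_def)
  note ext = prob_simplex_extend[OF simplex n(2)]
  have radius_ext: "kl_radius H m \<delta> H q = kl_radius H m \<delta> n q"
    by (simp add: kl_radius_def ext)
  have feas: "feasible H m \<delta> l q r \<longleftrightarrow> solves_bound H m \<delta> l n q r"
    by (simp add: feasible_def solves_bound_def ext radius_ext)
  have supp: "support H q = {1..n}"
  proof -
    have "0 < q i \<longleftrightarrow> i \<in> {1..n}" for i
      using simplex pos[of i] by (cases "i \<in> {1..n}") (auto simp: prob_simplex_def)
    then show ?thesis unfolding support_def using n(2) by fastforce
  qed
  define A where "A = mean_risk l n q"
  define c' where "c' = kl_radius H m \<delta> n q"
  define s where "s = sum_sq n q"
  define L where "L = ln ((1 - r) * A / (r * (1 - A)))"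
  have s: "0 < s" unfolding s_def by (rule sum_sq_pos[OF simplex])
  have c': "0 < c'" using c by (simp add: c'_def)
  have w: "q i = fp_weight H m \<delta> l n q r i \<longleftrightarrow> c' * q i / s = c' + (l i - A) * L" for i
  proof -
    have weight: "fp_weight H m \<delta> l n q r i = s * (1 + (l i - A) / c' * L)"
      by (simp add: fp_weight_def A_def c'_def s_def L_def)
    show ?thesis unfolding weight using s c' by (simp add: field_simps)
  qed
  show ?thesis
  proof (cases "solves_bound H m \<delta> l n q r")
    case False
    then show ?thesis by (simp add: stationary_point_def feas)
  next
    case True
    have r: "0 < r" "r < 1" "A < r"
      using True c' by (auto simp: solves_bound_def A_def[symmetric] c'_def[symmetric] less_le)
    have grad_q: "((\<lambda>t. lagrangian H m \<delta> l \<nu> \<mu> (q(i := t)) r) has_real_derivative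
        \<nu> * (l i * L - c' * q i / s) + \<mu>) (at (q i))" if "i \<in> {1..n}" for i \<nu> \<mu>
      unfolding L_def A_def c'_def s_def
      using lagrangian_weight_derivative[of i H l q r m \<delta> \<nu> \<mu>] that n a c r
      by (simp add: ext radius_ext)
    have grad_r: "((\<lambda>t. lagrangian H m \<delta> l \<nu> \<mu> q t) has_real_derivative
        1 + \<nu> * ((r - A) / (r * (1 - r)))) (at r)" for \<nu> \<mu>
      unfolding A_def
      using lagrangian_bound_derivative[of l H q r m \<delta> \<nu> \<mu>] a r
      by (simp add: ext)
    have stat: "stationary_point H m \<delta> l n q r \<longleftrightarrow>
        (\<exists>\<nu> \<mu>. (\<forall>i\<in>{1..n}. \<nu> * (l i * L - c' * q i / s) + \<mu> = 0) \<and>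
                1 + \<nu> * ((r - A) / (r * (1 - r))) = 0)"
    proof -
      have "((\<lambda>t. lagrangian H m \<delta> l \<nu> \<mu> (q(i := t)) r) has_real_derivative 0) (at (q i))
          \<longleftrightarrow> \<nu> * (l i * L - c' * q i / s) + \<mu> = 0" if "i \<in> {1..n}" for i \<nu> \<mu>
        using grad_q[OF that, of \<nu> \<mu>] by (metis DERIV_unique)
      moreover have "((\<lambda>t. lagrangian H m \<delta> l \<nu> \<mu> q t) has_real_derivative 0) (at r)
          \<longleftrightarrow> 1 + \<nu> * ((r - A) / (r * (1 - r))) = 0" for \<nu> \<mu>
        using grad_r[of \<nu> \<mu>] by (metis DERIV_unique)
      ultimately show ?thesis
        using True r by (simp add: stationary_point_def feas supp ext A_def[symmetric])
    qed
    show ?thesis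
    proof (intro iffI conjI True)
      assume "stationary_point H m \<delta> l n q r"
      then obtain \<nu> \<mu> where eq: "\<And>i. i \<in> {1..n} \<Longrightarrow> \<nu> * (l i * L - c' * q i / s) + \<mu> = 0"
        and nu: "1 + \<nu> * ((r - A) / (r * (1 - r))) = 0"
        unfolding stat by blast
      have "\<nu> \<noteq> 0" using nu by auto
      define \<kappa> where "\<kappa> = \<mu> / \<nu>"
      have eq': "c' * q i / s = l i * L + \<kappa>" if "i \<in> {1..n}" for i
      proof -
        have "\<nu> * (l i * L - c' * q i / s + \<kappa>) = 0"
          using eq[OF that] \<open>\<nu> \<noteq> 0\<close> by (simp add: \<kappa>_def distrib_left)
        then show ?thesis using \<open>\<nu> \<noteq> 0\<close> by simp
      qed
      have "(\<Sum>i=1..n. q i * (c' * q i / s)) = (\<Sum>i=1..n. q i * (l i * L + \<kappa>))"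
        using eq' by (intro sum.cong) auto
      moreover have "(\<Sum>i=1..n. q i * (c' * q i / s)) = c' / s * (\<Sum>i=1..n. (q i)\<^sup>2)"
        by (simp add: sum_distrib_left power2_eq_square mult_ac)
      moreover have "(\<Sum>i=1..n. q i * (l i * L + \<kappa>))
          = (\<Sum>i=1..n. l i * q i) * L + (\<Sum>i=1..n. q i) * \<kappa>"
        by (simp add: sum_distrib_left sum.distrib distrib_left mult_ac)
      ultimately have "c' = A * L + \<kappa>"
        using s total by (simp add: A_def mean_risk_def s_def sum_sq_def)
      then show "\<forall>i\<in>{1..n}. q i = fp_weight H m \<delta> l n q r i"
        using eq' by (simp add: w algebra_simps)
    next
      assume "solves_bound H m \<delta> l n q r \<and> (\<forall>i\<in>{1..n}. q i = fp_weight H m \<delta> l n q r i)"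
      then have eq: "c' * q i / s = c' + (l i - A) * L" if "i \<in> {1..n}" for i
        using that w by blast
      \<comment> \<open>The multiplier \<open>\<nu>\<close> is forced by stationarity in \<open>r\<close>; the other one is \<open>\<nu> * (c' - A * L)\<close>.\<close>
      define \<nu> where "\<nu> = - (r * (1 - r) / (r - A))"
      have "1 + \<nu> * ((r - A) / (r * (1 - r))) = 0"
        using r by (simp add: \<nu>_def)
      moreover have "\<nu> * (l i * L - c' * q i / s) + \<nu> * (c' - A * L) = 0" if "i \<in> {1..n}" for i
        unfolding eq[OF that] by (simp add: algebra_simps)
      ultimately show "stationary_point H m \<delta> l n q r"
        unfolding stat by blast
    qed
  qed
qed

theorem theorem9:
  fixes l :: "nat \<Rightarrow> real" and H H' m :: nat and \<delta> :: real
  assumes "\<forall>i\<in>{1..H}. 0 \<le> l i \<and> l i \<le> 1"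
    and "mono_on {1..H} l"
    and "m \<ge> 1"
    and "0 < \<delta>" and "\<delta> < 1"
    and "1 \<le> H'" and "H' \<le> H"
  shows
    "(\<forall>q r. feasible H m \<delta> l q r \<and> card (support H q) = H' \<longrightarrow>
        (\<exists>q' r'. feasible H m \<delta> l q' r' \<and> support H q' = {1..H'} \<and> r' \<le> r)) \<and>
     (\<forall>q. best_posterior H m \<delta> l H' q \<longrightarrow>
        (\<exists>\<sigma>. bij_betw \<sigma> {1..H'} (support H q) \<and> (\<forall>i\<in>{1..H'}. l (\<sigma> i) = l i))) \<and>
     (\<forall>q\<in>prob_simplex_interior H'. 0 < mean_risk l H' q \<and> mean_risk l H' q < 1 \<longrightarrow>
        (\<exists>!r. solves_bound H m \<delta> l H' q r) \<and>
        (\<forall>r. solves_bound H m \<delta> l H' q r \<and> fixed_point H m \<delta> l H' q r \<longleftrightarrow>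
             stationary_point H m \<delta> l H' q r))"
proof -
  have l_nonneg: "\<forall>i\<in>{1..H}. 0 \<le> l i" and "1 \<le> H"
    using assms by auto
  \<comment> \<open>The first two claims are both read off from the rearranged posterior: \<open>r' \<le> r\<close> gives the first, and
      the case of equality gives the second.\<close>
  have improve: "\<exists>\<sigma> q' r'. bij_betw \<sigma> {1..H'} (support H q) \<and> feasible H m \<delta> l q' r' \<and>
      support H q' = {1..H'} \<and> r' \<le> r \<and> (r' = r \<longrightarrow> (\<forall>i\<in>{1..H'}. l (\<sigma> i) = l i))"
    if feas: "feasible H m \<delta> l q r" and card: "card (support H q) = H'" for q r
  proof -
    have q: "q \<in> prob_simplex H" and sol: "solves_bound H m \<delta> l H q r"
      using feas by (auto simp: feasible_def)
    obtain \<sigma> q' where bij: "bij_betw \<sigma> {1..H'} (support H q)"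
      and l_le: "\<And>i. i \<in> {1..H'} \<Longrightarrow> l i \<le> l (\<sigma> i)"
      and q': "q' \<in> prob_simplex H" "support H q' = {1..H'}" "sum_sq H q' = sum_sq H q"
      and gain: "mean_risk l H q - mean_risk l H q' = (\<Sum>i=1..H'. (l (\<sigma> i) - l i) * q (\<sigma> i))"
      using sorted_rearrangement[OF \<open>mono_on {1..H} l\<close> q card] by blast
    have pos: "0 < q (\<sigma> i)" if "i \<in> {1..H'}" for i
      using bij that by (auto simp: bij_betw_def support_def)
    have term_nonneg: "0 \<le> (l (\<sigma> i) - l i) * q (\<sigma> i)" if "i \<in> {1..H'}" for i
      using l_le[OF that] pos[OF that] by (intro mult_nonneg_nonneg) auto
    then have "0 \<le> mean_risk l H q - mean_risk l H q'"
      unfolding gain by (intro sum_nonneg) auto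
    then have mean_le: "mean_risk l H q' \<le> mean_risk l H q" by simp
    have mean_nonneg: "0 \<le> mean_risk l H q'"
      by (rule mean_risk_nonneg[OF l_nonneg q'(1)])
    have mean_lt: "mean_risk l H q' < 1"
      using mean_le sol by (auto simp: solves_bound_def)
    have radius: "kl_radius H m \<delta> H q' = kl_radius H m \<delta> H q"
      using q'(3) by (simp add: kl_radius_def)
    obtain r' where sol': "solves_bound H m \<delta> l H q' r'"
      using solves_bound_exists[OF mean_nonneg mean_lt
          kl_radius_pos[OF \<open>1 \<le> H\<close> \<open>m \<ge> 1\<close> \<open>0 < \<delta>\<close> q'(1)]] by blast
    note cmp = solves_bound_compare[OF sol sol' radius mean_nonneg mean_le]
    have "\<forall>i\<in>{1..H'}. l (\<sigma> i) = l i" if "r' = r"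
    proof -
      have "mean_risk l H q - mean_risk l H q' = 0"
        using cmp(2) mean_le that by force
      then have "\<forall>i\<in>{1..H'}. (l (\<sigma> i) - l i) * q (\<sigma> i) = 0"
        unfolding gain using term_nonneg by (subst (asm) sum_nonneg_eq_0_iff) auto
      then show ?thesis using pos by force
    qed
    then show ?thesis
      using bij q' sol' cmp(1) by (auto simp: feasible_def)
  qed
  show ?thesis
  proof (intro conjI allI impI ballI)
    fix q r assume "feasible H m \<delta> l q r \<and> card (support H q) = H'"
    then show "\<exists>q' r'. feasible H m \<delta> l q' r' \<and> support H q' = {1..H'} \<and> r' \<le> r"
      using improve by blast
  next
    fix q assume "best_posterior H m \<delta> l H' q"
    then obtain r where card: "card (support H q) = H'" and feas: "feasible H m \<delta> l q r"
      and best: "\<And>q' r'. feasible H m \<delta> l q' r' \<Longrightarrow> card (support H q') = H' \<Longrightarrow> r \<le> r'"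
      unfolding best_posterior_def by blast
    obtain \<sigma> q' r' where *: "bij_betw \<sigma> {1..H'} (support H q)" "feasible H m \<delta> l q' r'"
      "support H q' = {1..H'}" "r' \<le> r" "r' = r \<longrightarrow> (\<forall>i\<in>{1..H'}. l (\<sigma> i) = l i)"
      using improve[OF feas card] by blast
    have "r \<le> r'" using best[OF *(2)] *(3) by simp
    then show "\<exists>\<sigma>. bij_betw \<sigma> {1..H'} (support H q) \<and> (\<forall>i\<in>{1..H'}. l (\<sigma> i) = l i)"
      using * by force
  next
    fix q assume q: "q \<in> prob_simplex_interior H'"
      and a: "0 < mean_risk l H' q \<and> mean_risk l H' q < 1"
    then have simplex: "q \<in> prob_simplex H'" by (simp add: prob_simplex_interior_def)
    have c: "0 < kl_radius H m \<delta> H' q"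
      by (rule kl_radius_pos[OF \<open>1 \<le> H\<close> \<open>m \<ge> 1\<close> \<open>0 < \<delta>\<close> simplex])
    show "\<exists>!r. solves_bound H m \<delta> l H' q r"
    proof (rule ex_ex1I)
      show "\<exists>r. solves_bound H m \<delta> l H' q r"
        using solves_bound_exists[of l H' q H m \<delta>] a c by (meson less_imp_le)
      show "r = r'" if "solves_bound H m \<delta> l H' q r" "solves_bound H m \<delta> l H' q r'" for r r'
        using solves_bound_compare(1)[OF that] solves_bound_compare(1)[OF that(2,1)] a by auto
    qed
    show "solves_bound H m \<delta> l H' q r \<and> fixed_point H m \<delta> l H' q r \<longleftrightarrow>
             stationary_point H m \<delta> l H' q r" for r
      using stationary_iff_weights[OF q \<open>1 \<le> H'\<close> \<open>H' \<le> H\<close> _ _ c] fixed_point_iff_weights[OF q] a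
      by simp
  qed
qed

end
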